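(* For every positive integer $\mu$ there exists a unit interval graph $G$ such that no set of at most $\mu$ spanning trees of $G$ collectively $+1$-spans $G$.
   Context: All graphs are connected, finite, undirected, loopless and without multiple edges; $\mathrm{dist}_G(u,v)$ is the number of edges of a shortest path between $u$ and $v$ in $G$. For $c\ge 0$, a set $\mathcal{T}$ of spanning trees of a graph $G$ collectively $+c$-spans $G$ if for any two vertices $u,v$ of $G$ there is a tree $T\in\mathcal{T}$ with $\mathrm{dist}_T(u,v)\le \mathrm{dist}_G(u,v)+c$. A graph is a unit interval graph if one can associate with each vertex an interval on the real line, all intervals having the same length, such that two vertices are adjacent if and only if the corresponding intervals intersect. *)

theory Defs
  imports "Graph_Theory.Graph_Theory"
begin

text \<open>
  Finite simple undirected graphs are the symmetric loop-free digraphs of the locale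
  \<^locale>\<open>pair_graph\<close>: an undirected edge is a pair of opposite arcs, and arcs being pairs of
  vertices there are no multiple edges. \<^const>\<open>Digraph_Component.connected\<close> also requires
  a non-empty vertex set.
\<close>

definition connected_graph :: "'a pair_pre_digraph \<Rightarrow> bool" where
  "connected_graph G \<longleftrightarrow> pair_graph G \<and> Digraph_Component.connected (with_proj G)"

text \<open>
  The library's \<^const>\<open>tree\<close> is not suitable for undirected graphs: its acyclicity condition is
  about directed cycles, so that already two opposite arcs form a cycle. In a symmetric digraph
  the cycles of the underlying undirected graph are the directed cycles of length at least 3.
\<close>

definition undirected_tree :: "'a pair_pre_digraph \<Rightarrow> bool" where
  "undirected_tree T \<longleftrightarrow> connected_graph T \<and>
     \<not> (\<exists>p. pre_digraph.cycle (with_proj T) p \<and> length p \<ge> 3)"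

definition undirected_spanning_tree :: "'a pair_pre_digraph \<Rightarrow> 'a pair_pre_digraph \<Rightarrow> bool" where
  "undirected_spanning_tree T G \<longleftrightarrow>
     undirected_tree T \<and> spanning (with_proj T) (with_proj G)"

text \<open>The cost of a cheapest walk when every arc has weight 1.\<close>

definition graph_dist :: "'a pair_pre_digraph \<Rightarrow> 'a \<Rightarrow> 'a \<Rightarrow> ereal" where
  "graph_dist G u v = wf_digraph.\<mu> (with_proj G) (\<lambda>_. 1) u v"

definition collectively_spans :: "real \<Rightarrow> 'a pair_pre_digraph set \<Rightarrow> 'a pair_pre_digraph \<Rightarrow> bool" where
  "collectively_spans c \<T> G \<longleftrightarrow>
     (\<forall>T\<in>\<T>. undirected_spanning_tree T G) \<and>
     (\<forall>u\<in>pverts G. \<forall>v\<in>pverts G. \<exists>T\<in>\<T>. graph_dist T u v \<le> graph_dist G u v + ereal c)"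

text \<open>
  Intervals are closed. The condition is about distinct vertices only, since an interval meets
  itself but graphs have no loops.
\<close>

definition unit_interval_graph :: "'a pair_pre_digraph \<Rightarrow> bool" where
  "unit_interval_graph G \<longleftrightarrow> connected_graph G \<and>
     (\<exists>(l :: 'a \<Rightarrow> real) L. L > 0 \<and>
        (\<forall>u\<in>pverts G. \<forall>v\<in>pverts G. u \<noteq> v \<longrightarrow>
           ((u, v) \<in> parcs G \<longleftrightarrow> {l u .. l u + L} \<inter> {l v .. l v + L} \<noteq> {})))"

text \<open>
  For connected graphs, \<^const>\<open>graph_dist\<close> is attained by a path and is the least number of arcs
  of a path.
\<close>

lemma graph_dist_shortest_path:
  assumes "connected_graph G" "u \<in> pverts G" "v \<in> pverts G"
  shows "\<exists>p. pre_digraph.apath (with_proj G) u p v \<and> graph_dist G u v = ereal (real (length p)) \<and>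
           (\<forall>q. pre_digraph.apath (with_proj G) u q v \<longrightarrow> length p \<le> length q)"
proof -
  interpret pair_graph G
    using assms(1) by (simp add: connected_graph_def)
  have cost: "awalk_cost (\<lambda>_. 1) p = real (length p)" for p
    by (induct p) auto
  have "u \<rightarrow>\<^sup>*\<^bsub>with_proj (mk_symmetric (with_proj G))\<^esub> v"
    using assms unfolding connected_graph_def connected_def strongly_connected_def
    by auto
  then have "u \<rightarrow>\<^sup>*\<^bsub>with_proj G\<^esub> v"
    by (simp only: reachable_mk_symmetric_eq[OF pair_sym_arcs])
  then obtain p where p: "apath u p v" "\<mu> (\<lambda>_. 1) u v = ereal (awalk_cost (\<lambda>_. 1) p)"
    using min_cost_awalk[of u v "\<lambda>_. 1"] by auto
  have "length p \<le> length q" if "apath u q v" for q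
    using min_cost_le_walk_cost[of u q v "\<lambda>_. 1"] p that cost
    by (auto simp: apath_def)
  then show ?thesis
    using p cost by (auto simp: graph_dist_def)
qed

end

theory Submission
  imports Defs
begin

text \<open>
  Take a long chain of cut vertices in which consecutive ones are joined through a clique of
  \<open>N\<close> vertices. For a tree \<open>T\<close> and a clique vertex \<open>u\<close>, let \<open>R\<close> and \<open>L\<close> be the distances in \<open>T\<close>
  from \<open>u\<close> to the next and the previous cut vertex, each diminished by 1. A path in \<open>T\<close> between
  clique vertices \<open>u\<close> and \<open>v\<close> of different cliques, \<open>u\<close> to the left, exceeds the distance in the
  graph by at least \<open>R u + L v\<close>. In each clique only boundedly many vertices satisfy
  \<open>R u + L u \<le> 1\<close>, because they lie on the path in \<open>T\<close> between the two cut vertices; so for large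
  \<open>N\<close> each clique has a vertex with \<open>R u + L u \<ge> 2\<close> for all the given trees. If the chain is long,
  two of these vertices agree in \<open>min R 2\<close> for every tree, by the pigeonhole principle, and then
  \<open>R u + L v \<ge> 2\<close> in every tree.
\<close>

section \<open>Near-shortest walks under a height function\<close>

text \<open>For \<open>h\<close> the height in the chain, \<open>A\<close> the arcs of a spanning
  tree and \<open>u\<close> a clique vertex, \<open>Domain (rises h A)\<close> and
  \<open>Domain (flats h A O rises h A)\<close> express \<open>R u = 0\<close> and
  \<open>R u = 1\<close>, while \<open>Range (rises h A)\<close> and
  \<open>Range (rises h A O flats h A)\<close> express \<open>L u = 0\<close> and
  \<open>L u = 1\<close>.\<close>

definition rises :: "('a \<Rightarrow> nat) \<Rightarrow> 'a rel \<Rightarrow> 'a rel" where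
  "rises h A = {(x, y) \<in> A. h y = Suc (h x)}"

definition flats :: "('a \<Rightarrow> nat) \<Rightarrow> 'a rel \<Rightarrow> 'a rel" where
  "flats h A = {(x, y) \<in> A. h y = h x}"

lemma pcas_append: "pcas u (p @ q) v \<longleftrightarrow> (\<exists>w. pcas u p w \<and> pcas w q v)"
  by (induction p arbitrary: u) auto

lemma pcas_height_le:
  assumes "\<And>x y. (x, y) \<in> A \<Longrightarrow> h y \<le> Suc (h x)" "set p \<subseteq> A" "pcas u p v"
  shows "h v \<le> h u + length p"
  using assms(2,3)
proof (induction p arbitrary: u)
  case (Cons e p)
  then have "h (snd e) \<le> Suc (h u)" "h v \<le> h (snd e) + length p"
    using assms(1)[of "fst e" "snd e"] by auto
  then show ?case by simp
qed auto

text \<open>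
  A walk that climbs \<open>D\<close> levels in at most \<open>D + 1\<close> steps of height at most 1 has at most one step
  that does not rise.
\<close>

lemma near_shortest_walk_ends:
  assumes lip: "\<And>x y. (x, y) \<in> A \<Longrightarrow> h y \<le> Suc (h x)"
    and p: "set p \<subseteq> A" "pcas u p v"
    and len: "h v = h u + D" "length p \<le> Suc D" "2 \<le> D"
  shows "u \<in> Domain (rises h A) \<and> v \<in> Range (rises h A) \<union> Range (rises h A O flats h A) \<or>
         u \<in> Domain (flats h A O rises h A) \<and> v \<in> Range (rises h A)"
proof -
  note le = pcas_height_le[of A h, OF lip]
  have "D \<le> length p"
    using le[OF _ p] len by simp
  \<comment> \<open>Since \<open>2 \<le> D\<close>, the first and the last arc of the walk are
    different; \<open>q\<close> will be the part between them.\<close>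
  then obtain u' x p' where p': "p = (u', x) # p'" "p' \<noteq> []"
    using len(3) by (cases p; cases "tl p") auto
  then obtain q y v' where "p' = q @ [(y, v')]"
    by (cases p' rule: rev_cases) auto
  with p p' have q: "p = (u, x) # q @ [(y, v)]" "pcas x q y" "set q \<subseteq> A"
    and ux: "(u, x) \<in> A" and yv: "(y, v) \<in> A"
    by (auto simp: pcas_append)
  have hx: "h x \<le> Suc (h u)" and hv: "h v \<le> Suc (h y)"
    using lip ux yv by auto
  have hy: "h y \<le> h x + length q" and lq: "Suc (length q) \<le> D"
    using le[OF _ q(3,2)] len q(1) by auto
  \<comment> \<open>If exactly one of the two end arcs fails to rise, it uses up the only spare
    step: it is flat, and the arc of \<open>q\<close> next to it rises. If both fail, the walk is
    too short to climb \<open>D\<close> levels.\<close>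
  consider "h x = Suc (h u)" "h v = Suc (h y)" | "h x = Suc (h u)" "h v \<le> h y"
    | "h x \<le> h u" "h v = Suc (h y)" | "h x \<le> h u" "h v \<le> h y"
    using hx hv by linarith
  then show ?thesis
  proof cases
    case 1
    then show ?thesis using ux yv unfolding rises_def by blast
  next
    case 2
    then have "h v = h y" "Suc (length q) = D"
      using hy lq len by linarith+
    moreover from this(2) obtain q' z where z: "q = q' @ [(z, y)]"
      using q(2) len(3) by (cases q rule: rev_cases) (auto simp: pcas_append)
    then have "h z \<le> h x + length q'" "(z, y) \<in> A"
      using q le[of q' x z] by (auto simp: pcas_append)
    moreover from this have "h y \<le> Suc (h z)" using lip by blast
    ultimately have "h y = Suc (h z)"
      using z 2 len by auto
    then have "(z, y) \<in> rises h A" "(y, v) \<in> flats h A" "(u, x) \<in> rises h A"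
      using \<open>(z, y) \<in> A\<close> ux yv 2 \<open>h v = h y\<close> unfolding rises_def flats_def by auto
    then show ?thesis by blast
  next
    case 3
    then have "h x = h u" "Suc (length q) = D"
      using hy lq len by linarith+
    moreover from this(2) obtain q' z where z: "q = (x, z) # q'"
      using q(2) len(3) by (cases q) auto
    then have "h y \<le> h z + length q'" "(x, z) \<in> A"
      using q le[of q' z y] by auto
    moreover from this have "h z \<le> Suc (h x)" using lip by blast
    ultimately have "h z = Suc (h x)"
      using z 3 len by auto
    then have "(x, z) \<in> rises h A" "(u, x) \<in> flats h A" "(y, v) \<in> rises h A"
      using \<open>(x, z) \<in> A\<close> ux yv 3 \<open>h x = h u\<close> unfolding rises_def flats_def by auto
    then show ?thesis by blast
  next
    case 4
    then show ?thesis using hy lq len by linarith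
  qed
qed

section \<open>Short paths in trees\<close>

text \<open>Phrased with recursive functions on arc lists, so that simplification can check an
  explicitly listed cycle.\<close>

lemma undirected_tree_no_cycle:
  assumes "undirected_tree T" "set p \<subseteq> parcs T" "pcas u p u"
    "distinct (tl (pawalk_verts u p))" "3 \<le> length p"
  shows False
proof -
  interpret pair_graph T
    using assms(1) by (simp add: undirected_tree_def connected_graph_def)
  have "u \<in> pverts T"
    using assms(2,3,5) by (cases p) (auto dest: in_arcsD1)
  then have "cycle p"
    unfolding cycle_def awalk_def using assms by auto
  then show False
    using assms(1,5) unfolding undirected_tree_def by blast
qed

lemma undirected_tree_irrefl: "undirected_tree T \<Longrightarrow> (x, x) \<notin> parcs T"
proof -
  assume "undirected_tree T"
  then interpret pair_graph T
    by (simp add: undirected_tree_def connected_graph_def)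
  show "(x, x) \<notin> parcs T"
    using pair_no_loops by force
qed

lemma undirected_tree_symD: "undirected_tree T \<Longrightarrow> (x, y) \<in> parcs T \<Longrightarrow> (y, x) \<in> parcs T"
proof -
  assume "undirected_tree T" "(x, y) \<in> parcs T"
  then interpret pair_graph T
    by (simp add: undirected_tree_def connected_graph_def)
  show "(y, x) \<in> parcs T"
    using pair_sym_arcs \<open>(x, y) \<in> parcs T\<close> by (auto simp: symmetric_def elim: symE)
qed

text \<open>Two different midpoints would close a 4-cycle.\<close>

lemma undirected_tree_path2_unique:
  assumes T: "undirected_tree T"
    and "(c, u) \<in> parcs T" "(u, d) \<in> parcs T" "(c, v) \<in> parcs T" "(v, d) \<in> parcs T" "c \<noteq> d"
  shows "u = v"
proof (rule ccontr)
  assume "u \<noteq> v"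
  then show False
    using assms undirected_tree_irrefl[OF T]
    by (intro undirected_tree_no_cycle[OF T, of "[(c, u), (u, d), (d, v), (v, c)]" c])
      (auto intro: undirected_tree_symD[OF T])
qed

text \<open>Two paths with \<open>u \<noteq> v\<close> would close a cycle: a 4-cycle if
  \<open>y = z\<close>, a triangle if \<open>y = v\<close> or \<open>z = u\<close>, and a 6-cycle
  otherwise.\<close>

lemma undirected_tree_path3_unique:
  assumes T: "undirected_tree T"
    and u: "(c, u) \<in> parcs T" "(u, y) \<in> parcs T" "(y, d) \<in> parcs T"
    and v: "(c, v) \<in> parcs T" "(v, z) \<in> parcs T" "(z, d) \<in> parcs T"
    and ne: "c \<noteq> d" "u \<noteq> d" "v \<noteq> d" "y \<noteq> c" "z \<noteq> c"
  shows "u = v"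
proof (rule ccontr)
  assume "u \<noteq> v"
  note sym = undirected_tree_symD[OF T]
  note irr = undirected_tree_irrefl[OF T]
  consider "y = z" | "y = v" | "z = u" | "y \<noteq> z" "y \<noteq> v" "z \<noteq> u" by blast
  then show False
  proof cases
    case 1
    then show False
      using undirected_tree_path2_unique[OF T u(1,2), of v] v ne \<open>u \<noteq> v\<close> by auto
  next
    case 2
    then show False
      using u v irr \<open>u \<noteq> v\<close>
      by (intro undirected_tree_no_cycle[OF T, of "[(c, u), (u, v), (v, c)]" c]) (auto intro: sym)
  next
    case 3
    then show False
      using u v irr \<open>u \<noteq> v\<close>
      by (intro undirected_tree_no_cycle[OF T, of "[(c, v), (v, u), (u, c)]" c]) (auto intro: sym)
  next
    case 4
    then show False
      using u v irr ne \<open>u \<noteq> v\<close>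
      by (intro undirected_tree_no_cycle[OF T, of "[(c, u), (u, y), (y, d), (d, z), (z, v), (v, c)]" c])
        (auto intro: sym)
  qed
qed

lemma finite_card_le_1I: "(\<And>x y. x \<in> A \<Longrightarrow> y \<in> A \<Longrightarrow> x = y) \<Longrightarrow> finite A \<and> card A \<le> 1"
proof (cases "A = {}")
  case False
  assume eq: "\<And>x y. x \<in> A \<Longrightarrow> y \<in> A \<Longrightarrow> x = y"
  from False obtain a where "a \<in> A" by blast
  with eq have "A = {a}" by blast
  then show ?thesis by simp
qed simp

text \<open>
  The vertices of one level whose distances in the tree to the levels below and above add up to
  at most 3. If those levels are single vertices, the tree contains at most one path of each of
  the three possible shapes between them.
\<close>

definition straight :: "('a \<Rightarrow> nat) \<Rightarrow> 'a rel \<Rightarrow> 'a set" where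
  "straight h A =
     Domain (rises h A) \<inter> (Range (rises h A) \<union> Range (rises h A O flats h A)) \<union>
     Domain (flats h A O rises h A) \<inter> Range (rises h A)"

lemma card_straight_level:
  assumes T: "undirected_tree T"
    and below: "\<And>x y. x \<in> pverts T \<Longrightarrow> y \<in> pverts T \<Longrightarrow> h x = n \<Longrightarrow> h y = n \<Longrightarrow> x = y"
    and above: "\<And>x y. x \<in> pverts T \<Longrightarrow> y \<in> pverts T \<Longrightarrow> h x = n + 2 \<Longrightarrow> h y = n + 2 \<Longrightarrow> x = y"
  shows "finite {u \<in> straight h (parcs T). h u = Suc n} \<and>
         card {u \<in> straight h (parcs T). h u = Suc n} \<le> 3"
proof -
  interpret pair_graph T
    using T by (simp add: undirected_tree_def connected_graph_def)
  note sym = undirected_tree_symD[OF T]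
  let ?A = "parcs T"
  let ?P = "\<lambda>u. h u = Suc n"
  \<comment> \<open>The sets sort the vertices by the shape of the tree path from the lower vertex
    \<open>c\<close> to the upper vertex \<open>d\<close>: \<open>c u d\<close>,
    \<open>c u y d\<close> and \<open>c y u d\<close>.\<close>
  define K0 where "K0 = {u. ?P u \<and> (\<exists>c d. (c, u) \<in> ?A \<and> (u, d) \<in> ?A \<and> h c = n \<and> h d = n + 2)}"
  define K1 where "K1 = {u. ?P u \<and> (\<exists>c y d. (c, u) \<in> ?A \<and> (u, y) \<in> ?A \<and> (y, d) \<in> ?A \<and>
    h c = n \<and> h y = Suc n \<and> h d = n + 2)}"
  define K2 where "K2 = {u. ?P u \<and> (\<exists>c y d. (c, y) \<in> ?A \<and> (y, u) \<in> ?A \<and> (u, d) \<in> ?A \<and>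
    h c = n \<and> h y = Suc n \<and> h d = n + 2)}"
  have K0: "finite K0 \<and> card K0 \<le> 1"
  proof (rule finite_card_le_1I)
    fix u v assume "u \<in> K0" "v \<in> K0"
    then obtain c d c' d' where "(c, u) \<in> ?A" "(u, d) \<in> ?A" "h c = n" "h d = n + 2"
      "(c', v) \<in> ?A" "(v, d') \<in> ?A" "h c' = n" "h d' = n + 2"
      unfolding K0_def by blast
    moreover from this have "c' = c" "d' = d"
      using below above by (metis in_arcsD1 in_arcsD2)+
    ultimately show "u = v"
      by (intro undirected_tree_path2_unique[OF T, of c _ d]) auto
  qed
  have K1: "finite K1 \<and> card K1 \<le> 1"
  proof (rule finite_card_le_1I)
    fix u v assume uv: "u \<in> K1" "v \<in> K1"
    then obtain c y d c' y' d' where "(c, u) \<in> ?A" "(u, y) \<in> ?A" "(y, d) \<in> ?A" "h c = n" "h d = n + 2"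
      "(c', v) \<in> ?A" "(v, y') \<in> ?A" "(y', d') \<in> ?A" "h c' = n" "h d' = n + 2"
      "h y = Suc n" "h y' = Suc n"
      unfolding K1_def by blast
    moreover from this have "c' = c" "d' = d"
      using below above by (metis in_arcsD1 in_arcsD2)+
    ultimately show "u = v" using uv
      by (intro undirected_tree_path3_unique[OF T, of c _ y d _ y']) (auto simp: K1_def)
  qed
  have K2: "finite K2 \<and> card K2 \<le> 1"
  proof (rule finite_card_le_1I)
    fix u v assume uv: "u \<in> K2" "v \<in> K2"
    then obtain c y d c' y' d' where "(c, y) \<in> ?A" "(y, u) \<in> ?A" "(u, d) \<in> ?A" "h c = n" "h d = n + 2"
      "(c', y') \<in> ?A" "(y', v) \<in> ?A" "(v, d') \<in> ?A" "h c' = n" "h d' = n + 2"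
      "h y = Suc n" "h y' = Suc n"
      unfolding K2_def by blast
    moreover from this have "c' = c" "d' = d"
      using below above by (metis in_arcsD1 in_arcsD2)+
    \<comment> \<open>Read downwards from \<open>d\<close> to \<open>c\<close>, these paths have the
      shape treated in \<open>K1\<close>.\<close>
    ultimately show "u = v" using uv
      by (intro undirected_tree_path3_unique[OF T, of d _ y c _ y']) (auto simp: K2_def intro: sym)
  qed
  have "u \<in> K0 \<union> K1 \<union> K2" if u: "u \<in> straight h ?A" "?P u" for u
  proof -
    let ?R = "rises h ?A" and ?F = "flats h ?A"
    have "u \<in> K0" if "u \<in> Domain ?R" "u \<in> Range ?R"
      using that u(2) unfolding rises_def K0_def by fastforce
    moreover have "u \<in> K2" if "u \<in> Domain ?R" "u \<in> Range (?R O ?F)"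
      using that u(2) unfolding rises_def flats_def K2_def by fastforce
    moreover have "u \<in> K1" if "u \<in> Domain (?F O ?R)" "u \<in> Range ?R"
      using that u(2) unfolding rises_def flats_def K1_def by fastforce
    ultimately show ?thesis
      using u(1) unfolding straight_def by blast
  qed
  then have sub: "{u \<in> straight h ?A. ?P u} \<subseteq> K0 \<union> K1 \<union> K2"
    by blast
  have "card (K0 \<union> K1 \<union> K2) \<le> 3"
    using K0 K1 K2 card_Un_le[of K0 K1] card_Un_le[of "K0 \<union> K1" K2] by linarith
  then show ?thesis
    using sub K0 K1 K2 by (meson card_mono finite_Un finite_subset le_trans)
qed

section \<open>Chains of cliques\<close>

text \<open>
  Vertices \<open>v\<close> sit at height \<open>v div N\<close>: a single vertex at every even height, a clique of size
  \<open>N\<close> at every odd height.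
\<close>

definition clique_chain :: "nat \<Rightarrow> nat \<Rightarrow> nat pair_pre_digraph" where
  "clique_chain k N =
     (let V = {v. v div N \<le> 2 * k \<and> (even (v div N) \<longrightarrow> v mod N = 0)}
      in \<lparr>pverts = V,
          parcs = {(u, v) \<in> V \<times> V. u \<noteq> v \<and> u div N \<le> Suc (v div N) \<and> v div N \<le> Suc (u div N)}\<rparr>)"

lemma pverts_clique_chain:
  "v \<in> pverts (clique_chain k N) \<longleftrightarrow> v div N \<le> 2 * k \<and> (even (v div N) \<longrightarrow> v mod N = 0)"
  by (simp add: clique_chain_def)

lemma parcs_clique_chain:
  "(u, v) \<in> parcs (clique_chain k N) \<longleftrightarrow>
     u \<in> pverts (clique_chain k N) \<and> v \<in> pverts (clique_chain k N) \<and> u \<noteq> v \<and>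
     u div N \<le> Suc (v div N) \<and> v div N \<le> Suc (u div N)"
  by (simp add: clique_chain_def)

lemma pair_graph_clique_chain:
  assumes "N > 0"
  shows "pair_graph (clique_chain k N)"
proof
  have "v < Suc (2 * k) * N" if "v \<in> pverts (clique_chain k N)" for v
    using that unfolding pverts_clique_chain less_Suc_eq_le[symmetric] div_less_iff_less_mult[OF assms]
    by blast
  then have "pverts (clique_chain k N) \<subseteq> {..<Suc (2 * k) * N}"
    by blast
  then show fin: "finite (pverts (clique_chain k N))"
    by (rule finite_subset) simp
  have "parcs (clique_chain k N) \<subseteq> pverts (clique_chain k N) \<times> pverts (clique_chain k N)"
    by (auto simp: parcs_clique_chain)
  then show "finite (parcs (clique_chain k N))"
    using fin by (metis finite_SigmaI finite_subset)
  show "symmetric (with_proj (clique_chain k N))"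
    by (auto simp: symmetric_def sym_def parcs_clique_chain)
qed (auto simp: parcs_clique_chain)

lemma clique_chain_walk:
  assumes "N > 0" "u \<in> pverts (clique_chain k N)" "v \<in> pverts (clique_chain k N)"
    "v div N = u div N + Suc d"
  shows "\<exists>p. pre_digraph.awalk (with_proj (clique_chain k N)) u p v \<and> length p = Suc d"
proof -
  interpret pair_graph "clique_chain k N"
    using assms by (intro pair_graph_clique_chain)
  show ?thesis
    using assms(2,4)
  proof (induction d arbitrary: u)
    case 0
    then have "(u, v) \<in> parcs (clique_chain k N)"
      using assms(3) by (auto simp: parcs_clique_chain)
    then have "awalk u [(u, v)] v"
      using assms(3) by (simp add: awalk_simps)
    then show ?case by force
  next
    case (Suc d)
    \<comment> \<open>A multiple of \<open>N\<close> is a vertex at even and odd heights alike, so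
      the walk can climb through these without a parity split.\<close>
    define x where "x = Suc (u div N) * N"
    have h: "x div N = Suc (u div N)" "x mod N = 0"
      using assms(1) unfolding x_def by (metis nonzero_mult_div_cancel_right less_not_refl, simp)
    then have x: "x \<in> pverts (clique_chain k N)"
      using assms(3) Suc.prems unfolding pverts_clique_chain by simp
    then have "(u, x) \<in> parcs (clique_chain k N)"
      using Suc.prems h(1) unfolding parcs_clique_chain by auto
    moreover obtain p where "awalk x p v" "length p = Suc d"
      using Suc.IH[OF x] Suc.prems h(1) by auto
    ultimately have "awalk u ((u, x) # p) v \<and> length ((u, x) # p) = Suc (Suc d)"
      by (simp add: awalk_simps)
    then show ?case by blast
  qed
qed

lemma connected_clique_chain:
  assumes "N > 0"
  shows "connected_graph (clique_chain k N)"
proof -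
  let ?G = "clique_chain k N"
  interpret pair_graph ?G
    using assms by (rule pair_graph_clique_chain)
  have up: "u \<rightarrow>\<^sup>*\<^bsub>with_proj ?G\<^esub> v"
    if uv: "u \<in> pverts ?G" "v \<in> pverts ?G" "u div N \<le> v div N" for u v
  proof (cases "u div N = v div N")
    case True
    have "u \<rightarrow>\<^sup>*\<^bsub>with_proj ?G\<^esub> u"
      using uv by simp
    moreover have "u = v \<or> (u, v) \<in> parcs ?G"
      using True uv by (auto simp: parcs_clique_chain)
    ultimately show ?thesis
      by auto
  next
    case False
    then obtain d where "v div N = u div N + Suc d"
      using uv(3) by (metis less_natE order_le_less add_Suc_right)
    then show ?thesis
      using clique_chain_walk[OF assms uv(1,2)] reachable_awalk by blast
  qed
  have "u \<rightarrow>\<^sup>*\<^bsub>with_proj ?G\<^esub> v" if "u \<in> pverts ?G" "v \<in> pverts ?G" for u v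
    using up[of u v] up[of v u] that symmetric_reachable[OF pair_sym_arcs] by (meson nle_le)
  then have "u \<rightarrow>\<^sup>*\<^bsub>with_proj (mk_symmetric (with_proj ?G))\<^esub> v"
    if "u \<in> pverts ?G" "v \<in> pverts ?G" for u v
    using that by (simp only: reachable_mk_symmetric_eq[OF pair_sym_arcs])
  moreover have "0 \<in> pverts ?G"
    by (simp add: pverts_clique_chain)
  ultimately have "Digraph_Component.connected (with_proj ?G)"
    unfolding connected_def strongly_connected_def by auto
  then show ?thesis
    unfolding connected_graph_def using pair_graph_clique_chain[OF assms] by blast
qed

text \<open>Each vertex gets the closed interval of length 1 starting at its height; two such
  intervals meet, possibly in an endpoint only, iff the heights differ by at most 1.\<close>

lemma unit_interval_graph_clique_chain:
  assumes "N > 0"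
  shows "unit_interval_graph (clique_chain k N)"
proof -
  have "{real a..real a + 1} \<inter> {real b..real b + 1} \<noteq> {} \<longleftrightarrow> a \<le> Suc b \<and> b \<le> Suc a" for a b
    by auto
  then have "\<forall>u\<in>pverts (clique_chain k N). \<forall>v\<in>pverts (clique_chain k N). u \<noteq> v \<longrightarrow>
      ((u, v) \<in> parcs (clique_chain k N) \<longleftrightarrow>
       {real (u div N)..real (u div N) + 1} \<inter> {real (v div N)..real (v div N) + 1} \<noteq> {})"
    by (simp add: parcs_clique_chain)
  then show ?thesis
    unfolding unit_interval_graph_def using connected_clique_chain[OF assms]
    by (intro conjI exI[of _ "\<lambda>v. real (v div N)"] exI[of _ 1]) auto
qed

section \<open>Distances in the chain and in its spanning trees\<close>

lemma graph_dist_clique_chain_le: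
  assumes "N > 0" "u \<in> pverts (clique_chain k N)" "v \<in> pverts (clique_chain k N)"
    "v div N = u div N + D" "D > 0"
  shows "graph_dist (clique_chain k N) u v \<le> ereal (real D)"
proof -
  interpret pair_graph "clique_chain k N"
    using assms(1) by (rule pair_graph_clique_chain)
  have cost: "awalk_cost (\<lambda>_. 1) p = real (length p)" for p
    by (induct p) auto
  obtain p where "awalk u p v" "length p = D"
    using clique_chain_walk[OF assms(1-3), of "D - 1"] assms(4,5) by auto
  then show ?thesis
    using min_cost_le_walk_cost[of u p v "\<lambda>_. 1"] cost unfolding graph_dist_def by auto
qed

text \<open>The graph distance is at most \<open>D\<close>, so a shortest path in \<open>T\<close>
  has at most \<open>D + 1\<close> arcs. These are arcs of the chain and change the height by at
  most 1, so \<open>near_shortest_walk_ends\<close> applies. For clique vertices the result says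
  \<open>R u + L v \<le> 1\<close>.\<close>

lemma spanning_tree_clique_chain_walk_ends:
  assumes "N > 0" and T: "undirected_spanning_tree T (clique_chain k N)"
    and uv: "u \<in> pverts (clique_chain k N)" "v \<in> pverts (clique_chain k N)"
    and D: "v div N = u div N + D" "2 \<le> D"
    and dist: "graph_dist T u v \<le> graph_dist (clique_chain k N) u v + ereal 1"
  defines "h \<equiv> \<lambda>v. v div N" and "A \<equiv> parcs T"
  shows "u \<in> Domain (rises h A) \<and> v \<in> Range (rises h A) \<union> Range (rises h A O flats h A) \<or>
         u \<in> Domain (flats h A O rises h A) \<and> v \<in> Range (rises h A)"
proof -
  let ?G = "clique_chain k N"
  have conn: "connected_graph T" and "pverts T = pverts ?G" and sub: "parcs T \<subseteq> parcs ?G"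
    using T by (auto simp: undirected_spanning_tree_def undirected_tree_def spanning_def subgraph_def)
  then interpret pair_graph T
    by (simp add: connected_graph_def)
  obtain p where p: "apath u p v" "graph_dist T u v = ereal (real (length p))"
    using graph_dist_shortest_path[OF conn, of u v] uv \<open>pverts T = pverts ?G\<close> by auto
  have "graph_dist ?G u v \<le> ereal (real D)"
    using graph_dist_clique_chain_le[OF assms(1) uv D(1)] D(2) by simp
  then have "graph_dist ?G u v + ereal 1 \<le> ereal (real D) + ereal 1"
    by (rule add_right_mono)
  with dist p(2) have "ereal (real (length p)) \<le> ereal (real D + 1)"
    by (metis order_trans plus_ereal.simps(1))
  then have "length p \<le> Suc D" by simp
  moreover have "set p \<subseteq> A" "pcas u p v"
    using p(1) by (auto simp: apath_def awalk_def A_def)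
  ultimately show ?thesis
    using D sub by (intro near_shortest_walk_ends[of A h p u v D])
      (auto simp: h_def A_def parcs_clique_chain)
qed

text \<open>Each tree has at most three straight vertices in the clique, so the trees together
  cannot exhaust its \<open>N\<close> vertices.\<close>

lemma exists_not_straight:
  assumes "finite \<T>" and T: "\<And>T. T \<in> \<T> \<Longrightarrow> undirected_spanning_tree T (clique_chain k N)"
    and N: "3 * card \<T> < N" and "i < k"
  shows "\<exists>u \<in> pverts (clique_chain k N). u div N = Suc (2 * i) \<and>
           (\<forall>T\<in>\<T>. u \<notin> straight (\<lambda>v. v div N) (parcs T))"
proof -
  let ?G = "clique_chain k N"
  define C where "C = (\<lambda>r. Suc (2 * i) * N + r) ` {..<N}"
  define B where "B T = {u \<in> straight (\<lambda>v. v div N) (parcs T). u div N = Suc (2 * i)}"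
    for T :: "nat pair_pre_digraph"
  have C: "u \<in> pverts ?G \<and> u div N = Suc (2 * i)" if "u \<in> C" for u
  proof -
    from that obtain r where r: "r < N" "u = Suc (2 * i) * N + r"
      unfolding C_def by blast
    then have "u div N = Suc (2 * i)"
      by (simp only: div_mult_self3) simp
    then show ?thesis
      using \<open>i < k\<close> unfolding pverts_clique_chain by simp
  qed
  \<comment> \<open>The levels just below and above the clique have even height, hence are single
    vertices, as \<open>card_straight_level\<close> requires.\<close>
  have single: "x = y"
    if "x \<in> pverts ?G" "y \<in> pverts ?G" "x div N = n" "y div N = n" "even n" for x y n
    using that unfolding pverts_clique_chain by (metis mult_div_mod_eq)
  have B: "finite (B T) \<and> card (B T) \<le> 3" if "T \<in> \<T>" for T
  proof -
    have "undirected_tree T" "pverts T = pverts ?G"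
      using T[OF that] by (auto simp: undirected_spanning_tree_def spanning_def)
    then show ?thesis
      unfolding B_def by (intro card_straight_level) (auto intro: single)
  qed
  have "card (\<Union>(B ` \<T>)) \<le> (\<Sum>T\<in>\<T>. card (B T))"
    by (rule card_UN_le[OF \<open>finite \<T>\<close>])
  also have "\<dots> \<le> 3 * card \<T>"
    using sum_bounded_above[of \<T> "\<lambda>T. card (B T)" 3] B by (simp add: mult.commute)
  also have "\<dots> < card C"
    using N unfolding C_def by (subst card_image) (auto simp: inj_on_def)
  finally have "\<not> C \<subseteq> \<Union>(B ` \<T>)"
    using card_mono[of "\<Union>(B ` \<T>)" C] B \<open>finite \<T>\<close> by (meson finite_UN linorder_not_less)
  then obtain u where "u \<in> C" "u \<notin> \<Union>(B ` \<T>)" by blast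
  then show ?thesis
    using C unfolding B_def by blast
qed

theorem theorem1:
  fixes m :: nat
  assumes "m \<ge> 1"
  shows "\<exists>G :: nat pair_pre_digraph. unit_interval_graph G \<and>
           (\<forall>\<T>. finite \<T> \<and> card \<T> \<le> m \<and> (\<forall>T\<in>\<T>. undirected_spanning_tree T G) \<longrightarrow>
                 \<not> collectively_spans 1 \<T> G)"
proof -
  \<comment> \<open>There are at most \<open>4 ^ m\<close> pairs of subsets of \<open>\<T>\<close>;
    one more clique than that forces a repetition. \<open>N\<close> exceeds the at most
    \<open>3 * m\<close> straight vertices in a clique.\<close>
  define k :: nat where "k = Suc (4 ^ m)"
  define N where "N = Suc (3 * m)"
  let ?G = "clique_chain k N"
  let ?h = "\<lambda>v. v div N"
  have "N > 0" by (simp add: N_def)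
  have "\<not> collectively_spans 1 \<T> ?G"
    if "finite \<T>" "card \<T> \<le> m" and T: "\<And>T. T \<in> \<T> \<Longrightarrow> undirected_spanning_tree T ?G" for \<T>
  proof
    assume span: "collectively_spans 1 \<T> ?G"
    have "\<forall>i<k. \<exists>u \<in> pverts ?G. ?h u = Suc (2 * i) \<and> (\<forall>T\<in>\<T>. u \<notin> straight ?h (parcs T))"
      using exists_not_straight[OF \<open>finite \<T>\<close> T] \<open>card \<T> \<le> m\<close> by (auto simp: N_def)
    then obtain w where w: "\<And>i. i < k \<Longrightarrow> w i \<in> pverts ?G" "\<And>i. i < k \<Longrightarrow> ?h (w i) = Suc (2 * i)"
      "\<And>i T. i < k \<Longrightarrow> T \<in> \<T> \<Longrightarrow> w i \<notin> straight ?h (parcs T)"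
      by metis
    \<comment> \<open>The pair encodes \<open>min R 2\<close> at \<open>w i\<close> for all trees at
      once: the trees with \<open>R = 0\<close> and those with \<open>R = 1\<close>.\<close>
    define f where "f i = ({T \<in> \<T>. w i \<in> Domain (rises ?h (parcs T))},
      {T \<in> \<T>. w i \<in> Domain (flats ?h (parcs T) O rises ?h (parcs T))})" for i
    have "card (Pow \<T> \<times> Pow \<T>) = 4 ^ card \<T>"
      using \<open>finite \<T>\<close> by (simp add: card_Pow card_cartesian_product flip: power_mult_distrib)
    also have "\<dots> < card {..<k}"
      using power_increasing[OF \<open>card \<T> \<le> m\<close>, of "4::nat"] by (simp add: k_def del: power_increasing_iff)
    finally have "card (f ` {..<k}) < card {..<k}"
      using card_mono[of "Pow \<T> \<times> Pow \<T>" "f ` {..<k}"] \<open>finite \<T>\<close> by (force simp: f_def)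
    then have "\<not> inj_on f {..<k}"
      by (rule pigeonhole)
    then obtain i j where ij: "i < j" "j < k" "f i = f j"
      unfolding inj_on_def by (metis lessThan_iff linorder_neqE_nat)
    then obtain T where "T \<in> \<T>" "graph_dist T (w i) (w j) \<le> graph_dist ?G (w i) (w j) + ereal 1"
      using span w(1) unfolding collectively_spans_def by (meson order_less_trans)
    \<comment> \<open>The heights \<open>Suc (2 * i)\<close> and \<open>Suc (2 * j)\<close> differ
      by \<open>2 * (j - i)\<close>, which is at least 2.\<close>
    then have "w i \<in> Domain (rises ?h (parcs T)) \<and>
          w j \<in> Range (rises ?h (parcs T)) \<union> Range (rises ?h (parcs T) O flats ?h (parcs T)) \<or>
        w i \<in> Domain (flats ?h (parcs T) O rises ?h (parcs T)) \<and> w j \<in> Range (rises ?h (parcs T))"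
      using w(1,2) ij
      by (intro spanning_tree_clique_chain_walk_ends[OF \<open>N > 0\<close> T, where D = "2 * (j - i)"]) auto
    \<comment> \<open>As \<open>f i = f j\<close>, the condition on \<open>w i\<close> carries over
      to \<open>w j\<close>; together with the condition on \<open>w j\<close> it is the definition
      of \<open>straight\<close>.\<close>
    moreover have "w i \<in> Domain (rises ?h (parcs T)) \<longleftrightarrow> w j \<in> Domain (rises ?h (parcs T))"
      "w i \<in> Domain (flats ?h (parcs T) O rises ?h (parcs T)) \<longleftrightarrow>
       w j \<in> Domain (flats ?h (parcs T) O rises ?h (parcs T))"
      using ij(3) \<open>T \<in> \<T>\<close> unfolding f_def by blast+
    ultimately have "w j \<in> straight ?h (parcs T)"
      unfolding straight_def by blast
    then show False
      using w(3) ij(2) \<open>T \<in> \<T>\<close> by blast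
  qed
  then show ?thesis
    using unit_interval_graph_clique_chain[OF \<open>N > 0\<close>] by (intro exI[of _ ?G]) simp
qed

end
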